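(* For consistent RE theories whose language contains $\mathbf{0}$ and $\mathbf{S}$ (with "$P$ implies $Q$" meaning every such theory with $P$ has $Q$, and "$P$ does not imply $Q$" meaning some such theory has $P$ but not $Q$): (1) RFD implies RSS and RSW. (2) RSS does not imply RFD. (3) RSS implies RSW. (4) RSW does not imply RSS. (5) RSW does not imply RFD.
   Context: $\overline{n}=\mathbf{S}^n\mathbf{0}$. For a consistent RE theory $T$: $A\subseteq\mathbb{N}$ is weakly representable if some $\phi(x)$ has $n\in A\iff T\vdash\phi(\overline{n})$; strongly representable if some $\phi(x)$ has $n\in A\Rightarrow T\vdash\phi(\overline{n})$, $n\notin A\Rightarrow T\vdash\neg\phi(\overline{n})$; total $f:\mathbb{N}^k\to\mathbb{N}$ is definable if some $\phi(\vec x,y)$ has $T\vdash\forall y[\phi(\overline{a_1},\dots,\overline{a_k},y)\leftrightarrow y=\overline{f(\vec a)}]$ for all $\vec a$. RFD: every recursive function definable; RSS: every recursive set strongly representable; RSW: every recursive set weakly representable.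
   Formalization: Claim (1) is stated with the extra hypothesis that T proves two numerals distinct; without it the claim fails, e.g. for the theory with sole axiom "for all x, y: x = y", which has RFD but neither RSS nor RSW. *)

theory Defs
  imports Main "HOL-Library.Nat_Bijection"
begin

section \<open>Recursive functions and recursively enumerable sets\<close>

text \<open>Kleene's partial recursive functions: \<open>evals r xs y\<close> says that the function defined by
  the program \<open>r\<close> converges at the argument list \<open>xs\<close> with value \<open>y\<close>.  Programs carry no arity;
  \<open>Zero\<close> is the zero function of every arity.\<close>

datatype recf =
    Zero
  | Succ
  | Proj nat
  | Comp recf "recf list"
  | Prec recf recf
  | Mu recf

inductive evals :: "recf \<Rightarrow> nat list \<Rightarrow> nat \<Rightarrow> bool" where
  Zero: "evals Zero xs 0"
| Succ: "evals Succ [x] (Suc x)"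
| Proj: "i < length xs \<Longrightarrow> evals (Proj i) xs (xs ! i)"
| Comp: "list_all2 (\<lambda>g y. evals g xs y) gs ys \<Longrightarrow> evals f ys z \<Longrightarrow> evals (Comp f gs) xs z"
| Prec_0: "evals f xs y \<Longrightarrow> evals (Prec f g) (0 # xs) y"
| Prec_Suc: "evals (Prec f g) (n # xs) y \<Longrightarrow> evals g (n # y # xs) z \<Longrightarrow>
    evals (Prec f g) (Suc n # xs) z"
| Mu: "evals f (n # xs) 0 \<Longrightarrow> \<forall>m<n. \<exists>y. evals f (m # xs) (Suc y) \<Longrightarrow> evals (Mu f) xs n"
monos list_all2_mono

inductive_cases evals_elims:
  "evals Zero xs y" "evals Succ xs y" "evals (Proj i) xs y" "evals (Comp f gs) xs y"
  "evals (Prec f g) (0 # xs) y" "evals (Prec f g) (Suc n # xs) y" "evals (Mu f) xs y"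

lemma evals_deterministic: "evals r xs y \<Longrightarrow> evals r xs z \<Longrightarrow> y = z"
proof (induction arbitrary: z rule: evals.induct)
  case (Zero xs)
  then show ?case by (rule evals_elims(1)) simp
next
  case (Succ x)
  then show ?case by (rule evals_elims(2)) simp
next
  case (Proj i xs)
  from Proj.prems show ?case by (rule evals_elims(3)) simp
next
  case (Prec_0 f xs y g)
  from Prec_0.prems have "evals f xs z" by (rule evals_elims(5))
  then show ?case by (rule Prec_0.IH)
next
  case (Comp xs gs ys f w)
  from Comp.prems obtain ys' where ys': "list_all2 (\<lambda>g y. evals g xs y) gs ys'" "evals f ys' z"
    by (rule evals_elims(4))
  have "ys = ys'"
  proof (rule nth_equalityI)
    show "length ys = length ys'"
      using Comp.IH(1) ys'(1) by (simp add: list_all2_conv_all_nth)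
    fix i assume "i < length ys"
    with Comp.IH(1) ys'(1) show "ys ! i = ys' ! i"
      by (simp add: list_all2_conv_all_nth)
  qed
  with Comp.IH(2) ys'(2) show ?case by blast
next
  case (Prec_Suc f g n xs y z z')
  from Prec_Suc.prems obtain y' where "evals (Prec f g) (n # xs) y'" "evals g (n # y' # xs) z'"
    by (rule evals_elims(6))
  with Prec_Suc.IH show ?case by blast
next
  case (Mu f n xs)
  from Mu.prems have z: "evals f (z # xs) 0" "\<forall>m<z. \<exists>y. evals f (m # xs) (Suc y)"
    by (auto elim: evals_elims(7))
  show ?case
  proof (cases n z rule: linorder_cases)
    case less
    with z obtain y where "evals f (n # xs) (Suc y)" by blast
    with Mu.IH(1) show ?thesis by blast
  next
    case greater
    with Mu.IH(2) z(1) show ?thesis by blast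
  qed
qed

text \<open>A total function \<open>\<nat>\<^sup>k \<rightarrow> \<nat>\<close> is a function on lists, of which only the values at lists of
  length \<open>k\<close> matter.\<close>

definition recursive_fun :: "nat \<Rightarrow> (nat list \<Rightarrow> nat) \<Rightarrow> bool" where
  "recursive_fun k f \<longleftrightarrow> (\<exists>r. \<forall>xs. length xs = k \<longrightarrow> evals r xs (f xs))"

definition recursive_set :: "nat set \<Rightarrow> bool" where
  "recursive_set A \<longleftrightarrow> recursive_fun 1 (\<lambda>xs. if hd xs \<in> A then 1 else 0)"

definition re_set :: "nat set \<Rightarrow> bool" where
  "re_set A \<longleftrightarrow> (\<exists>r. \<forall>n. n \<in> A \<longleftrightarrow> (\<exists>y. evals r [n] y))"


section \<open>First-order logic with equality\<close>

text \<open>A function or relation symbol is a pair of a name and an arity, both natural numbers; the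
  arity is the number of arguments to which the name is applied.\<close>

datatype tm = Var nat | Fn nat "tm list"

datatype fm =
    Eq tm tm
  | Rel nat "tm list"
  | Neg fm
  | Imp fm fm
  | All nat fm

definition Conj :: "fm \<Rightarrow> fm \<Rightarrow> fm" where
  "Conj p q = Neg (Imp p (Neg q))"

definition Iff :: "fm \<Rightarrow> fm \<Rightarrow> fm" where
  "Iff p q = Conj (Imp p q) (Imp q p)"

record language =
  funs :: "(nat \<times> nat) set"
  rels :: "(nat \<times> nat) set"

fun tm_in :: "language \<Rightarrow> tm \<Rightarrow> bool" where
  "tm_in L (Var x) \<longleftrightarrow> True"
| "tm_in L (Fn f ts) \<longleftrightarrow> (f, length ts) \<in> funs L \<and> (\<forall>t\<in>set ts. tm_in L t)"

primrec fm_in :: "language \<Rightarrow> fm \<Rightarrow> bool" where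
  "fm_in L (Eq s t) \<longleftrightarrow> tm_in L s \<and> tm_in L t"
| "fm_in L (Rel r ts) \<longleftrightarrow> (r, length ts) \<in> rels L \<and> (\<forall>t\<in>set ts. tm_in L t)"
| "fm_in L (Neg p) \<longleftrightarrow> fm_in L p"
| "fm_in L (Imp p q) \<longleftrightarrow> fm_in L p \<and> fm_in L q"
| "fm_in L (All x p) \<longleftrightarrow> fm_in L p"

fun fv_tm :: "tm \<Rightarrow> nat set" where
  "fv_tm (Var x) = {x}"
| "fv_tm (Fn f ts) = (\<Union>t\<in>set ts. fv_tm t)"

primrec fv :: "fm \<Rightarrow> nat set" where
  "fv (Eq s t) = fv_tm s \<union> fv_tm t"
| "fv (Rel r ts) = (\<Union>t\<in>set ts. fv_tm t)"
| "fv (Neg p) = fv p"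
| "fv (Imp p q) = fv p \<union> fv q"
| "fv (All x p) = fv p - {x}"

fun subst_tm :: "(nat \<Rightarrow> tm) \<Rightarrow> tm \<Rightarrow> tm" where
  "subst_tm \<sigma> (Var x) = \<sigma> x"
| "subst_tm \<sigma> (Fn f ts) = Fn f (map (subst_tm \<sigma>) ts)"

text \<open>Simultaneous substitution for the free occurrences of variables; bound variables are not
  renamed, so capture has to be excluded where it is used.\<close>

primrec subst :: "(nat \<Rightarrow> tm) \<Rightarrow> fm \<Rightarrow> fm" where
  "subst \<sigma> (Eq s t) = Eq (subst_tm \<sigma> s) (subst_tm \<sigma> t)"
| "subst \<sigma> (Rel r ts) = Rel r (map (subst_tm \<sigma>) ts)"
| "subst \<sigma> (Neg p) = Neg (subst \<sigma> p)"
| "subst \<sigma> (Imp p q) = Imp (subst \<sigma> p) (subst \<sigma> q)"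
| "subst \<sigma> (All x p) = All x (subst (\<sigma>(x := Var x)) p)"

definition subst1 :: "nat \<Rightarrow> tm \<Rightarrow> fm \<Rightarrow> fm" where
  "subst1 x t p = subst (Var(x := t)) p"

primrec free_for :: "tm \<Rightarrow> nat \<Rightarrow> fm \<Rightarrow> bool" where
  "free_for t x (Eq s u) \<longleftrightarrow> True"
| "free_for t x (Rel r ts) \<longleftrightarrow> True"
| "free_for t x (Neg p) \<longleftrightarrow> free_for t x p"
| "free_for t x (Imp p q) \<longleftrightarrow> free_for t x p \<and> free_for t x q"
| "free_for t x (All y p) \<longleftrightarrow> x \<notin> fv (All y p) \<or> (y \<notin> fv_tm t \<and> free_for t x p)"

text \<open>Mendelson's Hilbert system, relative to a language \<open>L\<close> and a set \<open>T\<close> of sentences.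
  Every formula in a derivation is a formula of \<open>L\<close>.\<close>

inductive proves :: "language \<Rightarrow> fm set \<Rightarrow> fm \<Rightarrow> bool" for L T where
  Ax: "p \<in> T \<Longrightarrow> fm_in L p \<Longrightarrow> proves L T p"
| Imp_K: "fm_in L p \<Longrightarrow> fm_in L q \<Longrightarrow> proves L T (Imp p (Imp q p))"
| Imp_S: "fm_in L p \<Longrightarrow> fm_in L q \<Longrightarrow> fm_in L r \<Longrightarrow>
    proves L T (Imp (Imp p (Imp q r)) (Imp (Imp p q) (Imp p r)))"
| Contrapos: "fm_in L p \<Longrightarrow> fm_in L q \<Longrightarrow>
    proves L T (Imp (Imp (Neg p) (Neg q)) (Imp q p))"
| All_E: "fm_in L p \<Longrightarrow> tm_in L t \<Longrightarrow> free_for t x p \<Longrightarrow>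
    proves L T (Imp (All x p) (subst1 x t p))"
| All_Imp: "fm_in L p \<Longrightarrow> fm_in L q \<Longrightarrow> x \<notin> fv p \<Longrightarrow>
    proves L T (Imp (All x (Imp p q)) (Imp p (All x q)))"
| Eq_refl: "tm_in L t \<Longrightarrow> proves L T (Eq t t)"
| Eq_subst: "fm_in L p \<Longrightarrow> tm_in L s \<Longrightarrow> tm_in L t \<Longrightarrow> free_for s x p \<Longrightarrow> free_for t x p \<Longrightarrow>
    proves L T (Imp (Eq s t) (Imp (subst1 x s p) (subst1 x t p)))"
| MP: "proves L T (Imp p q) \<Longrightarrow> proves L T p \<Longrightarrow> proves L T q"
| Gen: "proves L T p \<Longrightarrow> proves L T (All x p)"

definition consistent :: "language \<Rightarrow> fm set \<Rightarrow> bool" where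
  "consistent L T \<longleftrightarrow> \<not> (\<exists>p. proves L T p \<and> proves L T (Neg p))"

fun code_tm :: "tm \<Rightarrow> nat" where
  "code_tm (Var x) = prod_encode (0, x)"
| "code_tm (Fn f ts) = prod_encode (1, prod_encode (f, list_encode (map code_tm ts)))"

primrec code_fm :: "fm \<Rightarrow> nat" where
  "code_fm (Eq s t) = prod_encode (0, prod_encode (code_tm s, code_tm t))"
| "code_fm (Rel r ts) = prod_encode (1, prod_encode (r, list_encode (map code_tm ts)))"
| "code_fm (Neg p) = prod_encode (2, code_fm p)"
| "code_fm (Imp p q) = prod_encode (3, prod_encode (code_fm p, code_fm q))"
| "code_fm (All x p) = prod_encode (4, prod_encode (x, code_fm p))"


section \<open>RE theories with numerals\<close>

text \<open>The constant \<open>\<zero>\<close> is the function symbol \<open>(0, 0)\<close> and the successor \<open>S\<close> is \<open>(1, 1)\<close>.\<close>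

primrec num :: "nat \<Rightarrow> tm" where
  "num 0 = Fn 0 []"
| "num (Suc n) = Fn 1 [num n]"

text \<open>A theory is given by its language, whose symbols form a recursive set (so that syntax is
  effective), and its set of axioms; it is RE if the set of codes of the axioms is.\<close>

definition consistent_RE_theory :: "language \<Rightarrow> fm set \<Rightarrow> bool" where
  "consistent_RE_theory L T \<longleftrightarrow>
     recursive_set (prod_encode ` funs L) \<and> recursive_set (prod_encode ` rels L) \<and>
     (0, 0) \<in> funs L \<and> (1, 1) \<in> funs L \<and>
     (\<forall>p\<in>T. fm_in L p \<and> fv p = {}) \<and>
     re_set (code_fm ` T) \<and>
     consistent L T"

text \<open>\<open>inst p [a\<^sub>1, \<dots>, a\<^sub>k]\<close> is \<open>p\<close> with the numerals of the \<open>a\<^sub>i\<close> put for the variables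
  \<open>0, \<dots>, k - 1\<close>; numerals are closed, so nothing is captured.\<close>

definition inst :: "fm \<Rightarrow> nat list \<Rightarrow> fm" where
  "inst p as = subst (\<lambda>i. if i < length as then num (as ! i) else Var i) p"

definition weakly_representable :: "language \<Rightarrow> fm set \<Rightarrow> nat set \<Rightarrow> bool" where
  "weakly_representable L T A \<longleftrightarrow>
     (\<exists>p. fm_in L p \<and> fv p \<subseteq> {0} \<and> (\<forall>n. n \<in> A \<longleftrightarrow> proves L T (inst p [n])))"

definition strongly_representable :: "language \<Rightarrow> fm set \<Rightarrow> nat set \<Rightarrow> bool" where
  "strongly_representable L T A \<longleftrightarrow>
     (\<exists>p. fm_in L p \<and> fv p \<subseteq> {0} \<and>
        (\<forall>n. (n \<in> A \<longrightarrow> proves L T (inst p [n])) \<and>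
             (n \<notin> A \<longrightarrow> proves L T (Neg (inst p [n])))))"

text \<open>In \<open>\<phi>(x\<^sub>1, \<dots>, x\<^sub>k, y)\<close> the variables \<open>0, \<dots>, k - 1\<close> play the role of the \<open>x\<^sub>i\<close>, and
  variable \<open>k\<close> that of \<open>y\<close>.\<close>

definition definable :: "language \<Rightarrow> fm set \<Rightarrow> nat \<Rightarrow> (nat list \<Rightarrow> nat) \<Rightarrow> bool" where
  "definable L T k f \<longleftrightarrow>
     (\<exists>p. fm_in L p \<and> fv p \<subseteq> {0..k} \<and>
        (\<forall>as. length as = k \<longrightarrow>
           proves L T (All k (Iff (inst p as) (Eq (Var k) (num (f as)))))))"

text \<open>\<open>RFD\<close> does not by itself separate any numerals: the consistent theory with the single axiom
  \<open>\<forall>x y. x = y\<close> satisfies it, but neither \<open>RSS\<close> nor \<open>RSW\<close>.  To conclude \<open>RSS\<close> from \<open>RFD\<close> one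
  needs in addition that two numerals are provably distinct, which \<open>RSS\<close> implies.\<close>

definition RFD :: "language \<Rightarrow> fm set \<Rightarrow> bool" where
  "RFD L T \<longleftrightarrow> (\<forall>k f. recursive_fun k f \<longrightarrow> definable L T k f)"

definition RSS :: "language \<Rightarrow> fm set \<Rightarrow> bool" where
  "RSS L T \<longleftrightarrow> (\<forall>A. recursive_set A \<longrightarrow> strongly_representable L T A)"

definition RSW :: "language \<Rightarrow> fm set \<Rightarrow> bool" where
  "RSW L T \<longleftrightarrow> (\<forall>A. recursive_set A \<longrightarrow> weakly_representable L T A)"

end

theory Submission
  imports Defs
begin

text \<open>If \<open>p\<close> defines the function with value \<open>m\<close> on \<open>A\<close> and \<open>n\<close> off \<open>A\<close>, and \<open>m \<noteq> n\<close> is provable,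
  then \<open>p(x, m)\<close> strongly represents \<open>A\<close>.

  For the separations, the inductive definition of the evaluation of programs is written as a finite
  set of equality-free Horn clauses for one ternary relation on codes, so that all computations become
  provable and no arithmetization inside the programs is needed to see that the theory is RE.  The
  clauses alone give RSW; as they hold in a one-point structure, they do not give RSS.  Adding that no
  program returns both \<open>0\<close> and \<open>1\<close> gives RSS.

  Since no axiom contains equality, the extended theory holds in two disjoint copies of its Herbrand
  model, with \<open>0\<close> taken from the first copy and \<open>S\<close> preserving copies.  A formula of small quantifier
  rank can connect a numeral \<open>c\<close> neither to \<open>0\<close> nor to a parameter \<open>a\<close> when \<open>c\<close> and \<open>\<bar>c - a\<bar>\<close> are
  large, so it cannot tell \<open>c\<close> from its twin in the second copy.  Hence \<open>a \<mapsto> 2a\<close> is not definable.\<close>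

section \<open>Substitution and soundness\<close>

lemma subst_tm_cong: "(\<And>x. x \<in> fv_tm t \<Longrightarrow> \<sigma> x = \<tau> x) \<Longrightarrow> subst_tm \<sigma> t = subst_tm \<tau> t"
  by (induction t) auto

lemma subst_tm_Var [simp]: "subst_tm Var t = t"
  by (induction t) (auto simp: map_idI)

lemma subst_tm_closed: "fv_tm t = {} \<Longrightarrow> subst_tm \<sigma> t = t"
  using subst_tm_cong[of t \<sigma> Var] by simp

lemma subst_cong: "(\<And>x. x \<in> fv p \<Longrightarrow> \<sigma> x = \<tau> x) \<Longrightarrow> subst \<sigma> p = subst \<tau> p"
proof (induction p arbitrary: \<sigma> \<tau>)
  case (Eq s t)
  then show ?case using subst_tm_cong[of s \<sigma> \<tau>] subst_tm_cong[of t \<sigma> \<tau>] by auto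
next
  case (Rel r ts)
  then show ?case by (auto intro!: subst_tm_cong)
next
  case (Neg p)
  from Neg.IH[of \<sigma> \<tau>] Neg.prems show ?case by auto
next
  case (Imp p q)
  from Imp.IH(1)[of \<sigma> \<tau>] Imp.IH(2)[of \<sigma> \<tau>] Imp.prems show ?case by auto
next
  case (All y p)
  have "subst (\<sigma>(y := Var y)) p = subst (\<tau>(y := Var y)) p"
    using All.prems by (intro All.IH) auto
  then show ?case by (simp only: subst.simps)
qed

lemma subst_Var [simp]: "subst Var p = p"
  by (induction p) (auto simp: map_idI fun_upd_idem)

text \<open>\<open>subst\<close> does not rename bound variables, so capture is excluded by allowing
  only closed images besides the variables themselves. The condition survives the reset of
  \<open>\<sigma>\<close> under a quantifier.\<close>

definition closed_subst :: "(nat \<Rightarrow> tm) \<Rightarrow> bool" where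
  "closed_subst \<sigma> \<longleftrightarrow> (\<forall>x. \<sigma> x = Var x \<or> fv_tm (\<sigma> x) = {})"

lemma closed_subst_upd: "closed_subst \<sigma> \<Longrightarrow> closed_subst (\<sigma>(x := Var x))"
  by (simp add: closed_subst_def)

lemma closed_subst_single: "fv_tm t = {} \<Longrightarrow> closed_subst (Var(x := t))"
  by (simp add: closed_subst_def)

lemma subst_tm_subst_tm: "subst_tm \<tau> (subst_tm \<sigma> t) = subst_tm (\<lambda>x. subst_tm \<tau> (\<sigma> x)) t"
  by (induction t) auto

lemma subst_subst:
  "closed_subst \<sigma> \<Longrightarrow> subst \<tau> (subst \<sigma> p) = subst (\<lambda>x. subst_tm \<tau> (\<sigma> x)) p"
proof (induction p arbitrary: \<sigma> \<tau>)
  case (All y p)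
  have "(\<lambda>x. subst_tm (\<tau>(y := Var y)) ((\<sigma>(y := Var y)) x)) =
      (\<lambda>x. subst_tm \<tau> (\<sigma> x))(y := Var y)"
  proof
    fix x
    consider "x = y" | "x \<noteq> y" "\<sigma> x = Var x" | "x \<noteq> y" "fv_tm (\<sigma> x) = {}"
      using All.prems by (auto simp: closed_subst_def)
    then show "subst_tm (\<tau>(y := Var y)) ((\<sigma>(y := Var y)) x) =
        ((\<lambda>x. subst_tm \<tau> (\<sigma> x))(y := Var y)) x"
      by cases (simp_all add: subst_tm_closed)
  qed
  then show ?case
    by (simp only: subst.simps All.IH[OF closed_subst_upd[OF All.prems, of y], of "\<tau>(y := Var y)"])
qed (simp_all add: subst_tm_subst_tm)

lemma fv_tm_subst_tm: "fv_tm (subst_tm \<sigma> t) = (\<Union>x\<in>fv_tm t. fv_tm (\<sigma> x))"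
  by (induction t) auto

lemma fv_tm_subst_closed: "fv_tm t = {} \<Longrightarrow> fv_tm (subst_tm (Var(x := t)) u) = fv_tm u - {x}"
  unfolding fv_tm_subst_tm by (auto split: if_splits)

lemma fv_subst1_closed: "fv_tm t = {} \<Longrightarrow> fv (subst1 x t p) = fv p - {x}"
proof (induction p)
  case (All y p)
  show ?case
  proof (cases "x = y")
    case True
    then show ?thesis by (simp add: subst1_def fun_upd_idem)
  next
    case False
    then have "(Var(x := t))(y := Var y) = Var(x := t)" by auto
    with All False show ?thesis by (auto simp: subst1_def)
  qed
qed (auto simp: subst1_def fv_tm_subst_closed simp del: fun_upd_apply)

lemma tm_in_subst_tm: "tm_in L t \<Longrightarrow> (\<And>x. tm_in L (\<sigma> x)) \<Longrightarrow> tm_in L (subst_tm \<sigma> t)"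
  by (induction t) auto

lemma fm_in_subst: "fm_in L p \<Longrightarrow> (\<And>x. tm_in L (\<sigma> x)) \<Longrightarrow> fm_in L (subst \<sigma> p)"
  by (induction p arbitrary: \<sigma>) (auto simp: tm_in_subst_tm)

lemma fm_in_subst1: "fm_in L p \<Longrightarrow> tm_in L t \<Longrightarrow> fm_in L (subst1 x t p)"
  by (simp add: subst1_def fm_in_subst)

lemma free_for_closed: "fv_tm t = {} \<Longrightarrow> free_for t x p"
  by (induction p) auto

lemma proves_fm_in: "proves L T p \<Longrightarrow> fm_in L p"
  by (induction rule: proves.induct) (auto simp: fm_in_subst1)

lemma proves_mono: "proves L T p \<Longrightarrow> T \<subseteq> T' \<Longrightarrow> proves L T' p"
  by (induction rule: proves.induct) (auto intro: proves.intros)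

section \<open>Tarskian semantics and soundness\<close>

fun val :: "(nat \<Rightarrow> 'd list \<Rightarrow> 'd) \<Rightarrow> (nat \<Rightarrow> 'd) \<Rightarrow> tm \<Rightarrow> 'd" where
  "val F e (Var x) = e x"
| "val F e (Fn f ts) = F f (map (val F e) ts)"

text \<open>Every name is interpreted at every arity and the domain is the whole type
  \<open>'d\<close>, so no language enters and quantifiers need no relativization.\<close>

primrec sat :: "(nat \<Rightarrow> 'd list \<Rightarrow> 'd) \<Rightarrow> (nat \<Rightarrow> 'd list \<Rightarrow> bool) \<Rightarrow> (nat \<Rightarrow> 'd) \<Rightarrow> fm \<Rightarrow> bool" where
  "sat F R e (Eq s t) \<longleftrightarrow> val F e s = val F e t"
| "sat F R e (Rel r ts) \<longleftrightarrow> R r (map (val F e) ts)"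
| "sat F R e (Neg p) \<longleftrightarrow> \<not> sat F R e p"
| "sat F R e (Imp p q) \<longleftrightarrow> (sat F R e p \<longrightarrow> sat F R e q)"
| "sat F R e (All x p) \<longleftrightarrow> (\<forall>d. sat F R (e(x := d)) p)"

lemma val_cong: "(\<And>x. x \<in> fv_tm t \<Longrightarrow> e x = e' x) \<Longrightarrow> val F e t = val F e' t"
proof (induction t)
  case (Fn f ts)
  then have "map (val F e) ts = map (val F e') ts"
    by (intro map_cong refl) (auto intro!: Fn.IH)
  then show ?case by (simp only: val.simps)
qed simp

lemma sat_cong: "(\<And>x. x \<in> fv p \<Longrightarrow> e x = e' x) \<Longrightarrow> sat F R e p = sat F R e' p"
proof (induction p arbitrary: e e')
  case (Eq s t)
  then show ?case using val_cong[of s e e' F] val_cong[of t e e' F] by auto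
next
  case (Rel r ts)
  then have "map (val F e) ts = map (val F e') ts"
    by (auto intro!: val_cong)
  then show ?case by (simp only: sat.simps)
next
  case (Neg p)
  from Neg.IH[of e e'] Neg.prems show ?case by auto
next
  case (Imp p q)
  from Imp.IH(1)[of e e'] Imp.IH(2)[of e e'] Imp.prems show ?case by auto
next
  case (All y p)
  have "sat F R (e(y := d)) p = sat F R (e'(y := d)) p" for d
    using All.prems by (auto intro!: All.IH)
  then show ?case by simp
qed

lemma val_subst_tm: "val F e (subst_tm \<sigma> t) = val F (\<lambda>x. val F e (\<sigma> x)) t"
proof (induction t)
  case (Fn f ts)
  then have "map (val F e \<circ> subst_tm \<sigma>) ts = map (val F (\<lambda>x. val F e (\<sigma> x))) ts"
    by simp
  then show ?case by (simp only: val.simps subst_tm.simps map_map)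
qed simp

lemma val_subst_tm_single: "val F e (subst_tm (Var(x := t)) u) = val F (e(x := val F e t)) u"
  unfolding val_subst_tm by (rule arg_cong[where f = "\<lambda>e. val F e u"]) auto

lemma sat_subst1:
  "free_for t x p \<Longrightarrow> sat F R e (subst1 x t p) = sat F R (e(x := val F e t)) p"
proof (induction p arbitrary: e)
  case (All y p)
  \<comment> \<open>The binder cancels the substitution, or the substitution is vacuous, or
    \<open>t\<close> does not contain \<open>y\<close>, so that the value of \<open>t\<close>
    ignores the new value of \<open>y\<close>.\<close>
  consider "y = x" | "y \<noteq> x" "x \<notin> fv p" | "y \<noteq> x" "y \<notin> fv_tm t" "free_for t x p"
    using All.prems by auto
  then show ?case
  proof cases
    case 1
    have "Var(x := Var x) = Var" by auto
    with 1 show ?thesis by (simp only: subst1_def subst.simps subst_Var sat.simps fun_upd_upd)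
  next
    case 2
    then have eq: "subst ((Var(x := t))(y := Var y)) p = p"
      using subst_cong[of p "(Var(x := t))(y := Var y)" Var]
      by (metis fun_upd_apply subst_Var)
    have sat: "sat F R (e(x := val F e t, y := d)) p = sat F R (e(y := d)) p" for d
      using 2 by (intro sat_cong) auto
    show ?thesis by (simp only: subst1_def subst.simps eq sat.simps sat)
  next
    case 3
    then have eq: "(Var(x := t))(y := Var y) = Var(x := t)" by auto
    have "sat F R (e(y := d)) (subst (Var(x := t)) p) = sat F R (e(x := val F e t, y := d)) p" for d
    proof -
      have "val F (e(y := d)) t = val F e t"
        using 3 by (intro val_cong) auto
      moreover have "e(y := d, x := val F e t) = e(x := val F e t, y := d)"
        using 3 by auto
      ultimately show ?thesis
        using All.IH[OF 3(3), of "e(y := d)"] unfolding subst1_def by metis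
    qed
    then show ?thesis by (simp only: subst1_def subst.simps eq sat.simps)
  qed
qed (simp_all add: subst1_def val_subst_tm_single comp_def del: fun_upd_apply)

lemma sat_closed_subst:
  "closed_subst \<sigma> \<Longrightarrow> sat F R e (subst \<sigma> p) = sat F R (\<lambda>x. val F e (\<sigma> x)) p"
proof (induction p arbitrary: \<sigma> e)
  case (All y p)
  have "(\<lambda>x. val F (e(y := d)) ((\<sigma>(y := Var y)) x)) = (\<lambda>x. val F e (\<sigma> x))(y := d)" for d
  proof
    fix x
    consider "x = y" | "x \<noteq> y" "\<sigma> x = Var x" | "x \<noteq> y" "fv_tm (\<sigma> x) = {}"
      using All.prems by (auto simp: closed_subst_def)
    then show "val F (e(y := d)) ((\<sigma>(y := Var y)) x) = ((\<lambda>x. val F e (\<sigma> x))(y := d)) x"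
      by cases (auto intro: val_cong)
  qed
  then show ?case
    by (simp only: subst.simps sat.simps All.IH[OF closed_subst_upd[OF All.prems, of y]])
qed (simp_all add: val_subst_tm comp_def)

theorem soundness:
  assumes "proves L T p" and "\<And>q e. q \<in> T \<Longrightarrow> sat F R e q"
  shows "sat F R e p"
  using assms(1)
proof (induction arbitrary: e rule: proves.induct)
  case (Ax p)
  then show ?case using assms(2) by blast
next
  case (All_Imp p q x)
  have "sat F R (e(x := d)) p = sat F R e p" for d
    using All_Imp by (intro sat_cong) auto
  then show ?case by simp
qed (auto simp: sat_subst1 simp del: fun_upd_apply)


section \<open>Derived rules\<close>

lemma proves_imp_trans:
  assumes "proves L T (Imp p q)" "proves L T (Imp q r)"
  shows "proves L T (Imp p r)"
proof -
  have in_L: "fm_in L p" "fm_in L q" "fm_in L r"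
    using assms[THEN proves_fm_in] by auto
  have "proves L T (Imp p (Imp q r))"
    by (rule proves.MP[OF proves.Imp_K assms(2)]) (use in_L in auto)
  from proves.MP[OF proves.MP[OF proves.Imp_S this] assms(1)] in_L show ?thesis by blast
qed

lemma proves_explosion:
  "fm_in L p \<Longrightarrow> fm_in L q \<Longrightarrow> proves L T (Imp (Neg p) (Imp p q))"
  by (rule proves_imp_trans[OF proves.Imp_K proves.Contrapos]) auto

lemma proves_dne:
  assumes "fm_in L p"
  shows "proves L T (Imp (Neg (Neg p)) p)"
proof -
  let ?n = "Neg (Neg p)"
  have self: "proves L T (Imp ?n ?n)"
    by (rule proves.MP[OF proves.MP[OF proves.Imp_S[of L ?n "Imp ?n ?n" ?n]]]; (rule proves.Imp_K)?)
      (use assms in auto)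
  \<comment> \<open>Ex falso makes \<open>?n\<close> imply \<open>Imp (Neg p) (Neg ?n)\<close>, and
    contraposition turns this into \<open>Imp ?n p\<close>. The next line contracts the repeated
    premise \<open>?n\<close>.\<close>
  have "proves L T (Imp ?n (Imp ?n p))"
    by (rule proves_imp_trans[OF proves_explosion proves.Contrapos]) (use assms in auto)
  from proves.MP[OF proves.MP[OF proves.Imp_S this] self] assms show ?thesis by simp
qed

lemma proves_dni:
  "fm_in L p \<Longrightarrow> proves L T (Imp p (Neg (Neg p)))"
  by (rule proves.MP[OF proves.Contrapos proves_dne]) auto

lemma proves_mt:
  assumes "proves L T (Imp p q)" "proves L T (Neg q)"
  shows "proves L T (Neg p)"
proof -
  have in_L: "fm_in L p" "fm_in L q"
    using assms(1)[THEN proves_fm_in] by auto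
  have "proves L T (Imp (Neg (Neg p)) (Neg (Neg q)))"
    by (rule proves_imp_trans[OF proves_imp_trans[OF proves_dne assms(1)] proves_dni])
      (use in_L in auto)
  then have "proves L T (Imp (Neg q) (Neg p))"
    by (rule proves.MP[OF proves.Contrapos, rotated -1]) (use in_L in auto)
  then show ?thesis using assms(2) by (rule proves.MP)
qed

lemma proves_ConjD:
  assumes "proves L T (Conj p q)"
  shows "proves L T p" "proves L T q"
proof -
  have in_L: "fm_in L p" "fm_in L q"
    using assms[THEN proves_fm_in] by (auto simp: Conj_def)
  \<comment> \<open>\<open>Conj p q\<close> is the negation of \<open>Imp p (Neg q)\<close>, so
    anything whose negation implies that formula follows by modus tollens and double
    negation.\<close>
  have *: "proves L T r" if "proves L T (Imp (Neg r) (Imp p (Neg q)))" "fm_in L r" for r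
    using proves.MP[OF proves_dne proves_mt[OF that(1) assms[unfolded Conj_def]]] that(2) .
  show "proves L T p" by (rule *[OF proves_explosion]) (use in_L in auto)
  show "proves L T q" by (rule *[OF proves.Imp_K]) (use in_L in auto)
qed

lemma proves_spec_closed:
  "proves L T (All x p) \<Longrightarrow> tm_in L t \<Longrightarrow> fv_tm t = {} \<Longrightarrow> proves L T (subst1 x t p)"
  by (rule proves.MP[OF proves.All_E]) (auto simp: free_for_closed dest: proves_fm_in)

lemma subst1_foldr_All: "v \<notin> set vs \<Longrightarrow> subst1 v t (foldr All vs p) = foldr All vs (subst1 v t p)"
proof (induction vs)
  case (Cons u vs)
  then have "(Var(v := t))(u := Var u) = Var(v := t)" by auto
  with Cons show ?case by (simp add: subst1_def del: fun_upd_apply)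
qed simp

text \<open>The quantifiers are removed from the outside in. Closed instances are untouched by the
  later substitutions, so the successive ones compose to \<open>\<sigma>\<close>.\<close>

lemma proves_closure_inst:
  assumes "proves L T (foldr All vs p)" "distinct vs"
    and "\<And>v. v \<in> set vs \<Longrightarrow> tm_in L (\<sigma> v) \<and> fv_tm (\<sigma> v) = {}"
    and "\<And>v. v \<notin> set vs \<Longrightarrow> \<sigma> v = Var v"
  shows "proves L T (subst \<sigma> p)"
  using assms
proof (induction vs arbitrary: p \<sigma>)
  case Nil
  then have "\<sigma> = Var" by auto
  with Nil show ?case by simp
next
  case (Cons v vs)
  let ?\<sigma>' = "\<sigma>(v := Var v)"
  have closed: "fv_tm (\<sigma> v) = {}" "tm_in L (\<sigma> v)"
    using Cons.prems(3) by auto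
  have "proves L T (foldr All vs (subst1 v (\<sigma> v) p))"
    using proves_spec_closed[of L T v "foldr All vs p" "\<sigma> v"] Cons.prems(1,2) closed
    by (simp add: subst1_foldr_All)
  then have "proves L T (subst ?\<sigma>' (subst1 v (\<sigma> v) p))"
    using Cons.prems(2-4) by (intro Cons.IH) auto
  moreover have "(\<lambda>x. subst_tm ?\<sigma>' ((Var(v := \<sigma> v)) x)) = \<sigma>"
    using closed by (auto simp: subst_tm_closed)
  ultimately show ?case
    using closed by (simp add: subst1_def subst_subst closed_subst_single)
qed


section \<open>Positive results\<close>

lemma fv_num [simp]: "fv_tm (num n) = {}"
  by (induction n) auto

lemma subst_tm_num [simp]: "subst_tm \<sigma> (num n) = num n"
  by (simp add: subst_tm_closed)

lemma tm_in_num: "(0, 0) \<in> funs L \<Longrightarrow> (1, 1) \<in> funs L \<Longrightarrow> tm_in L (num n)"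
  by (induction n) auto

lemma closed_subst_inst: "closed_subst (\<lambda>i. if i < length as then num (as ! i) else Var i)"
  by (simp add: closed_subst_def)

primrec const_prog :: "nat \<Rightarrow> recf" where
  "const_prog 0 = Zero"
| "const_prog (Suc n) = Comp Succ [const_prog n]"

lemma evals_Comp1: "evals g xs y \<Longrightarrow> evals f [y] z \<Longrightarrow> evals (Comp f [g]) xs z"
  by (rule evals.Comp[where ys = "[y]"]) auto

lemma evals_const_prog: "evals (const_prog n) xs n"
  by (induction n) (auto intro: evals.Zero evals_Comp1 evals.Succ)

lemma recursive_set_iff:
  "recursive_set A \<longleftrightarrow> (\<exists>r. \<forall>n. evals r [n] (if n \<in> A then 1 else 0))"
  unfolding recursive_set_def recursive_fun_def
proof (intro ex_cong1 iffI allI impI)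
  fix r n assume "\<forall>xs. length xs = 1 \<longrightarrow> evals r xs (if hd xs \<in> A then 1 else 0)"
  then show "evals r [n] (if n \<in> A then 1 else 0)" by (metis length_Cons list.sel(1) list.size(3) One_nat_def)
next
  fix r and xs :: "nat list"
  assume "\<forall>n. evals r [n] (if n \<in> A then 1 else 0)" "length xs = 1"
  then show "evals r xs (if hd xs \<in> A then 1 else 0)" by (cases xs) auto
qed

lemma recursive_fun_two_valued:
  assumes "recursive_set A"
  shows "recursive_fun 1 (\<lambda>xs. if hd xs \<in> A then m else n)"
proof -
  obtain r where r: "\<And>x. evals r [x] (if x \<in> A then 1 else 0)"
    using assms recursive_set_iff by auto
  \<comment> \<open>Recursion serves as a case distinction: \<open>n\<close> at 0, and
    \<open>m\<close> at 1 whatever the recursive value is.\<close>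
  let ?c = "Prec (const_prog n) (const_prog m)"
  have c0: "evals ?c [0] n" by (intro evals.Prec_0 evals_const_prog)
  have c1: "evals ?c [1] m"
    using evals.Prec_Suc[OF c0 evals_const_prog] by simp
  have "evals (Comp ?c [r]) [x] (if x \<in> A then m else n)" for x
    using evals_Comp1[OF r[of x], of ?c] c0 c1 by (cases "x \<in> A") auto
  then have "evals (Comp ?c [r]) xs (if hd xs \<in> A then m else n)" if "length xs = 1" for xs
    using that by (cases xs) auto
  then show ?thesis unfolding recursive_fun_def by blast
qed

lemma RFD_imp_RSS:
  assumes T: "consistent_RE_theory L T" and mn: "proves L T (Neg (Eq (num m) (num n)))"
    and RFD: "RFD L T"
  shows "RSS L T"
  unfolding RSS_def
proof (intro allI impI)
  fix A assume "recursive_set A"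
  define f where "f xs = (if hd xs \<in> A then m else n)" for xs
  have "recursive_fun 1 f"
    unfolding f_def using \<open>recursive_set A\<close> by (rule recursive_fun_two_valued)
  with RFD obtain p where p: "fm_in L p" "fv p \<subseteq> {0..1}"
    "\<And>as. length as = 1 \<Longrightarrow> proves L T (All 1 (Iff (inst p as) (Eq (Var 1) (num (f as)))))"
    unfolding RFD_def definable_def by blast
  have num: "tm_in L (num k)" for k
    using T by (intro tm_in_num) (auto simp: consistent_RE_theory_def)
  let ?q = "subst1 1 (num m) p"
  \<comment> \<open>The two substitutions insert closed terms for the different variables 0 and 1,
    so they commute.\<close>
  have inst: "inst ?q [a] = subst1 1 (num m) (inst p [a])" for a
    unfolding inst_def subst1_def
    by (subst (1 2) subst_subst)
      (auto simp: closed_subst_inst closed_subst_single intro!: arg_cong[where f = "\<lambda>s. subst s p"],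
       auto simp: closed_subst_def)
  \<comment> \<open>With \<open>m\<close> for the output variable, the right-hand side of the
    defining equivalence becomes \<open>m = m\<close> or \<open>m = n\<close>, according to whether
    \<open>a \<in> A\<close>.\<close>
  have *: "proves L T (Imp (inst ?q [a]) (Eq (num m) (num (f [a]))))"
    "proves L T (Imp (Eq (num m) (num (f [a]))) (inst ?q [a]))" for a
  proof -
    have "proves L T (Iff (inst ?q [a]) (Eq (num m) (num (f [a]))))"
      using proves_spec_closed[OF p(3)[of "[a]"] num fv_num, of m]
      unfolding inst by (simp add: Iff_def Conj_def subst1_def)
    then show "proves L T (Imp (inst ?q [a]) (Eq (num m) (num (f [a]))))"
      "proves L T (Imp (Eq (num m) (num (f [a]))) (inst ?q [a]))"
      unfolding Iff_def by (blast dest: proves_ConjD)+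
  qed
  have "proves L T (inst ?q [a])" if "a \<in> A" for a
    using proves.MP[OF *(2) ] proves.Eq_refl[OF num] that by (simp add: f_def)
  moreover have "proves L T (Neg (inst ?q [a]))" if "a \<notin> A" for a
    using proves_mt[OF *(1)] mn that by (simp add: f_def)
  moreover have "fm_in L ?q" "fv ?q \<subseteq> {0}"
    using p num by (auto simp: fm_in_subst1 fv_subst1_closed)
  ultimately show "strongly_representable L T A"
    unfolding strongly_representable_def by blast
qed

lemma RSS_imp_RSW:
  assumes "consistent_RE_theory L T" "RSS L T"
  shows "RSW L T"
  unfolding RSW_def
proof (intro allI impI)
  fix A assume "recursive_set A"
  then obtain p where p: "fm_in L p" "fv p \<subseteq> {0}"
    "\<And>n. n \<in> A \<Longrightarrow> proves L T (inst p [n])" "\<And>n. n \<notin> A \<Longrightarrow> proves L T (Neg (inst p [n]))"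
    using assms(2) unfolding RSS_def strongly_representable_def by blast
  \<comment> \<open>Consistency is what prevents the formula from being provable at some
    \<open>n\<close> outside \<open>A\<close>.\<close>
  then have "n \<in> A \<longleftrightarrow> proves L T (inst p [n])" for n
    using assms(1) unfolding consistent_RE_theory_def consistent_def by blast
  with p show "weakly_representable L T A"
    unfolding weakly_representable_def by blast
qed


section \<open>Finite sets are recursive\<close>

text \<open>Shifting the set down by one lowers the bound. \<open>Prec\<close> then answers at 0
  directly and at \<open>Suc n\<close> asks the program of the shifted set about \<open>n\<close>,
  dropping the recursive value.\<close>

lemma recursive_set_bounded: "A \<subseteq> {..<N} \<Longrightarrow> recursive_set A"
proof (induction N arbitrary: A)
  case 0
  then show ?case by (auto simp: recursive_set_iff intro!: exI[of _ Zero] evals.Zero)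
next
  case (Suc N)
  have "recursive_set {n. Suc n \<in> A}"
    using Suc.prems by (intro Suc.IH) auto
  then obtain q where q: "\<And>n. evals q [n] (if Suc n \<in> A then 1 else 0)"
    by (auto simp: recursive_set_iff)
  let ?r = "Prec (const_prog (if 0 \<in> A then 1 else 0)) (Comp q [Proj 0])"
  have "evals ?r [n] (if n \<in> A then 1 else 0)" for n
  proof (induction n)
    case 0
    show ?case by (rule evals.Prec_0) (rule evals_const_prog)
  next
    case (Suc n)
    have "evals (Proj 0) [n, y] n" for y
      using evals.Proj[of 0 "[n, y]"] by simp
    from evals.Prec_Suc[OF Suc evals_Comp1[OF this q]] show ?case .
  qed
  then show ?case using recursive_set_iff by blast
qed

lemma finite_imp_recursive_set: "finite A \<Longrightarrow> recursive_set A"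
  by (rule recursive_set_bounded[where N = "Suc (Max A)"]) (auto simp: less_Suc_eq_le)

lemma recursive_imp_re_set:
  assumes "recursive_set A"
  shows "re_set A"
proof -
  \<comment> \<open>The indicator is reversed because \<open>Mu\<close> searches for a zero.\<close>
  obtain r where r: "\<And>n. evals r [n] (if n \<in> A then 0 else 1)"
    using recursive_fun_two_valued[OF assms, of 0 1] unfolding recursive_fun_def
    by (metis One_nat_def length_Cons list.sel(1) list.size(3))
  \<comment> \<open>\<open>Mu\<close> puts the search variable in front, hence
    \<open>Proj 1\<close>. The test ignores that variable, so the search stops at once or
    never.\<close>
  have g: "evals (Comp r [Proj 1]) [k, n] (if n \<in> A then 0 else 1)" for k n
  proof -
    have "evals (Proj 1) [k, n] n" using evals.Proj[of 1 "[k, n]"] by simp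
    then show ?thesis using r by (rule evals_Comp1)
  qed
  let ?m = "Mu (Comp r [Proj 1])"
  have "evals ?m [n] 0" if "n \<in> A" for n
    using evals.Mu[of "Comp r [Proj 1]" 0 "[n]"] g[of 0 n] that by simp
  moreover have "n \<in> A" if "evals ?m [n] y" for n y
  proof -
    from that have "evals (Comp r [Proj 1]) [y, n] 0" by (rule evals_elims(7))
    from evals_deterministic[OF this g] show ?thesis by (auto split: if_splits)
  qed
  ultimately show ?thesis unfolding re_set_def by blast
qed


section \<open>A finite Horn theory of computations\<close>

abbreviation Z :: tm where "Z \<equiv> Fn 0 []"
abbreviation S :: "tm \<Rightarrow> tm" where "S t \<equiv> Fn (Suc 0) [t]"
abbreviation proj :: "tm \<Rightarrow> tm" where "proj t \<equiv> Fn 2 [t]"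
abbreviation mu :: "tm \<Rightarrow> tm" where "mu t \<equiv> Fn 3 [t]"
abbreviation nonzero :: "tm \<Rightarrow> tm" where "nonzero t \<equiv> Fn 4 [t]"
abbreviation cons :: "tm \<Rightarrow> tm \<Rightarrow> tm" where "cons s t \<equiv> Fn 5 [s, t]"
abbreviation comp :: "tm \<Rightarrow> tm \<Rightarrow> tm" where "comp s t \<equiv> Fn 6 [s, t]"
abbreviation prec :: "tm \<Rightarrow> tm \<Rightarrow> tm" where "prec s t \<equiv> Fn 7 [s, t]"
abbreviation Ev :: "tm \<Rightarrow> tm \<Rightarrow> tm \<Rightarrow> fm" where "Ev e xs y \<equiv> Rel 0 [e, xs, y]"

definition comp_lang :: language where
  "comp_lang = \<lparr>funs = {(0,0), (1,1), (2,1), (3,1), (4,1), (5,2), (6,2), (7,2)}, rels = {(0,3)}\<rparr>"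

text \<open>\<open>Z\<close> serves as the numeral, as the empty list and as the program \<open>Zero\<close>; a list of programs
  is itself a program that returns the list of the results.  The auxiliary program \<open>nonzero f\<close> is
  defined, with value \<open>0\<close>, at the lists \<open>n # xs\<close> such that \<open>f\<close> is positive at \<open>m # xs\<close> for all
  \<open>m < n\<close>.\<close>

inductive evt :: "tm \<Rightarrow> tm \<Rightarrow> tm \<Rightarrow> bool" where
  zero: "evt Z xs Z"
| succ: "evt (S Z) (cons x Z) (S x)"
| proj_0: "evt (proj Z) (cons x xs) x"
| proj_S: "evt (proj i) xs y \<Longrightarrow> evt (proj (S i)) (cons x xs) y"
| cons: "evt g xs y \<Longrightarrow> evt gs xs ys \<Longrightarrow> evt (cons g gs) xs (cons y ys)"
| comp: "evt gs xs ys \<Longrightarrow> evt f ys z \<Longrightarrow> evt (comp f gs) xs z"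
| prec_0: "evt f xs y \<Longrightarrow> evt (prec f g) (cons Z xs) y"
| prec_S: "evt (prec f g) (cons n xs) y \<Longrightarrow> evt g (cons n (cons y xs)) z \<Longrightarrow>
    evt (prec f g) (cons (S n) xs) z"
| nonzero_0: "evt (nonzero f) (cons Z xs) Z"
| nonzero_S: "evt (nonzero f) (cons n xs) Z \<Longrightarrow> evt f (cons n xs) (S y) \<Longrightarrow>
    evt (nonzero f) (cons (S n) xs) Z"
| mu: "evt (nonzero f) (cons n xs) Z \<Longrightarrow> evt f (cons n xs) Z \<Longrightarrow> evt (mu f) xs n"

text \<open>All clauses are closed over the same six variables, so that one instantiation lemma
  serves for all of them.\<close>

definition closure :: "fm \<Rightarrow> fm" where
  "closure p = foldr All [0..<6] p"

text \<open>The eleven clauses transcribe the rules of \<open>evt\<close>, in the same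
  order.\<close>

definition horn_clauses :: "fm set" where
  "horn_clauses = (let e = Var 0; f = Var 1; n = Var 2; xs = Var 3; y = Var 4; z = Var 5 in
    {Ev Z xs Z,
     Ev (S Z) (cons n Z) (S n),
     Ev (proj Z) (cons n xs) n,
     Imp (Ev (proj e) xs y) (Ev (proj (S e)) (cons n xs) y),
     Imp (Ev e xs y) (Imp (Ev f xs z) (Ev (cons e f) xs (cons y z))),
     Imp (Ev e xs y) (Imp (Ev f y z) (Ev (comp f e) xs z)),
     Imp (Ev e xs y) (Ev (prec e f) (cons Z xs) y),
     Imp (Ev (prec e f) (cons n xs) y) (Imp (Ev f (cons n (cons y xs)) z)
       (Ev (prec e f) (cons (S n) xs) z)),
     Ev (nonzero e) (cons Z xs) Z,
     Imp (Ev (nonzero e) (cons n xs) Z) (Imp (Ev e (cons n xs) (S y))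
       (Ev (nonzero e) (cons (S n) xs) Z)),
     Imp (Ev (nonzero e) (cons n xs) Z) (Imp (Ev e (cons n xs) Z) (Ev (mu e) xs n))})"

definition conflict :: fm where
  "conflict = Imp (Ev (Var 0) (Var 3) Z) (Neg (Ev (Var 0) (Var 3) (S Z)))"

definition horn_theory :: "fm set" where
  "horn_theory = closure ` horn_clauses"

definition horn_theory' :: "fm set" where
  "horn_theory' = insert (closure conflict) horn_theory"

definition ground :: "tm \<Rightarrow> bool" where
  "ground t \<longleftrightarrow> tm_in comp_lang t \<and> fv_tm t = {}"

lemma proves_closure:
  assumes "closure p \<in> T" "fm_in comp_lang p" "length ts = 6" "\<And>t. t \<in> set ts \<Longrightarrow> ground t"
  shows "proves comp_lang T (subst (\<lambda>i. if i < 6 then ts ! i else Var i) p)"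
proof (rule proves_closure_inst)
  have "fm_in comp_lang (foldr All vs p)" for vs
    using assms(2) by (induction vs) auto
  then show "proves comp_lang T (foldr All [0..<6] p)"
    using assms(1) unfolding closure_def by (intro proves.Ax) auto
  show "distinct [0..<6]" by simp
qed (use assms(3,4) in \<open>auto simp: ground_def\<close>)

lemma fm_in_horn: "p \<in> horn_clauses \<Longrightarrow> fm_in comp_lang p"
  by (auto simp: horn_clauses_def comp_lang_def Let_def)

lemma proves_horn:
  assumes "horn_theory \<subseteq> T" "p \<in> horn_clauses" "\<And>t. t \<in> {e, f, n, xs, y, z} \<Longrightarrow> ground t"
  shows "proves comp_lang T (subst (\<lambda>i. if i < 6 then [e, f, n, xs, y, z] ! i else Var i) p)"
  using assms fm_in_horn by (intro proves_closure) (auto simp: horn_theory_def)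

lemma ground_simps [simp]:
  "ground Z" "ground (S t) \<longleftrightarrow> ground t" "ground (proj t) \<longleftrightarrow> ground t"
  "ground (mu t) \<longleftrightarrow> ground t" "ground (nonzero t) \<longleftrightarrow> ground t"
  "ground (cons s t) \<longleftrightarrow> ground s \<and> ground t" "ground (comp s t) \<longleftrightarrow> ground s \<and> ground t"
  "ground (prec s t) \<longleftrightarrow> ground s \<and> ground t"
  by (auto simp: comp_lang_def ground_def)

lemma horn_instances:
  assumes "horn_theory \<subseteq> T" "ground e" "ground f" "ground n" "ground xs" "ground y" "ground z"
  shows "proves comp_lang T (Ev Z xs Z)"
    and "proves comp_lang T (Ev (S Z) (cons n Z) (S n))"
    and "proves comp_lang T (Ev (proj Z) (cons n xs) n)"
    and "proves comp_lang T (Imp (Ev (proj e) xs y) (Ev (proj (S e)) (cons n xs) y))"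
    and "proves comp_lang T (Imp (Ev e xs y) (Imp (Ev f xs z) (Ev (cons e f) xs (cons y z))))"
    and "proves comp_lang T (Imp (Ev e xs y) (Imp (Ev f y z) (Ev (comp f e) xs z)))"
    and "proves comp_lang T (Imp (Ev e xs y) (Ev (prec e f) (cons Z xs) y))"
    and "proves comp_lang T (Imp (Ev (prec e f) (cons n xs) y)
      (Imp (Ev f (cons n (cons y xs)) z) (Ev (prec e f) (cons (S n) xs) z)))"
    and "proves comp_lang T (Ev (nonzero e) (cons Z xs) Z)"
    and "proves comp_lang T (Imp (Ev (nonzero e) (cons n xs) Z) (Imp (Ev e (cons n xs) (S y))
       (Ev (nonzero e) (cons (S n) xs) Z)))"
    and "proves comp_lang T (Imp (Ev (nonzero e) (cons n xs) Z) (Imp (Ev e (cons n xs) Z)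
       (Ev (mu e) xs n)))"
proof -
  have "\<forall>p\<in>horn_clauses.
      proves comp_lang T (subst (\<lambda>i. if i < 6 then [e, f, n, xs, y, z] ! i else Var i) p)"
    using assms by (intro ballI proves_horn) auto
  then show "proves comp_lang T (Ev Z xs Z)"
    "proves comp_lang T (Ev (S Z) (cons n Z) (S n))"
    "proves comp_lang T (Ev (proj Z) (cons n xs) n)"
    "proves comp_lang T (Imp (Ev (proj e) xs y) (Ev (proj (S e)) (cons n xs) y))"
    "proves comp_lang T (Imp (Ev e xs y) (Imp (Ev f xs z) (Ev (cons e f) xs (cons y z))))"
    "proves comp_lang T (Imp (Ev e xs y) (Imp (Ev f y z) (Ev (comp f e) xs z)))"
    "proves comp_lang T (Imp (Ev e xs y) (Ev (prec e f) (cons Z xs) y))"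
    "proves comp_lang T (Imp (Ev (prec e f) (cons n xs) y)
      (Imp (Ev f (cons n (cons y xs)) z) (Ev (prec e f) (cons (S n) xs) z)))"
    "proves comp_lang T (Ev (nonzero e) (cons Z xs) Z)"
    "proves comp_lang T (Imp (Ev (nonzero e) (cons n xs) Z) (Imp (Ev e (cons n xs) (S y))
       (Ev (nonzero e) (cons (S n) xs) Z)))"
    "proves comp_lang T (Imp (Ev (nonzero e) (cons n xs) Z) (Imp (Ev e (cons n xs) Z)
       (Ev (mu e) xs n)))"
    by (simp_all add: horn_clauses_def Let_def)
qed

lemma num_simps [simp]: "num 0 = Z" "num (Suc n) = S (num n)" "num 1 = S Z"
  by simp_all

text \<open>The rules for \<open>nonzero\<close> start at \<open>Z\<close> and add one
  \<open>S\<close> at a time, so the search argument is a numeral. Through the first premise of the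
  rule \<open>mu\<close>, this shows that minimization returns numerals.\<close>

lemma evt_nonzero:
  "evt (nonzero f) ns z \<Longrightarrow>
    \<exists>k ys. ns = cons (num k) ys \<and> (\<forall>j<k. \<exists>w. evt f (cons (num j) ys) (S w))"
proof (induction "nonzero f" ns z rule: evt.induct)
  case (nonzero_0 xs)
  show ?case by (intro exI[of _ 0]) simp
next
  case (nonzero_S n xs y)
  then obtain k where "n = num k" "\<forall>j<k. \<exists>w. evt f (cons (num j) xs) (S w)" by auto
  with nonzero_S show ?case by (intro exI[of _ "Suc k"]) (auto simp: less_Suc_eq)
qed simp_all

lemma ground_num [simp]: "ground (num n)"
  by (simp add: tm_in_num comp_lang_def ground_def)

text \<open>Each rule of \<open>evt\<close> is replayed by an instance of its clause and modus
  ponens. Groundness of the value is carried along because the clauses are instantiated with ground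
  terms only.\<close>

lemma evt_imp_proves:
  assumes "horn_theory \<subseteq> T"
  shows "evt e xs y \<Longrightarrow> ground e \<Longrightarrow> ground xs \<Longrightarrow> ground y \<and> proves comp_lang T (Ev e xs y)"
proof (induction rule: evt.induct)
  note h = horn_instances[OF assms]
  {
    case (zero xs)
    then show ?case using h(1)[of Z Z Z xs Z Z] by simp
  next
    case (succ x)
    then show ?case using h(2)[of Z Z x Z Z Z] by simp
  next
    case (proj_0 x xs)
    then show ?case using h(3)[of Z Z x xs Z Z] by simp
  next
    case (proj_S i xs y x)
    then show ?case using proves.MP[OF h(4)[of i Z x xs y Z]] by simp
  next
    case (cons e xs y gs ys)
    then show ?case using proves.MP[OF proves.MP[OF h(5)[of e gs Z xs y ys]]] by simp
  next
    case (comp gs xs ys f z)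
    then show ?case using proves.MP[OF proves.MP[OF h(6)[of gs f Z xs ys z]]] by simp
  next
    case (prec_0 f xs y k)
    then show ?case using proves.MP[OF h(7)[of f k Z xs y Z]] by simp
  next
    case (prec_S f k n xs y z)
    then show ?case using proves.MP[OF proves.MP[OF h(8)[of f k n xs y z]]] by simp
  next
    case (nonzero_0 f xs)
    then show ?case using h(9)[of f Z Z xs Z Z] by simp
  next
    case (nonzero_S f n xs y)
    then show ?case using proves.MP[OF proves.MP[OF h(10)[of f Z n xs y Z]]] by simp
  next
    case (mu f n xs)
    \<comment> \<open>The result of a minimization is not built from the program, its arguments or
      earlier values, so its groundness must come from its being a numeral.\<close>
    moreover have "ground n"
      using evt_nonzero[OF mu.hyps(1)] by auto
    ultimately show ?case using proves.MP[OF proves.MP[OF h(11)[of f Z n xs Z Z]]] by simp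
  }
qed

section \<open>Translation of programs into terms\<close>

definition list_tm :: "tm list \<Rightarrow> tm" where
  "list_tm ts = foldr cons ts Z"

lemma list_tm_simps [simp]: "list_tm [] = Z" "list_tm (t # ts) = cons t (list_tm ts)"
  by (simp_all add: list_tm_def)

fun prog_tm :: "recf \<Rightarrow> tm" where
  "prog_tm Zero = Z"
| "prog_tm Succ = S Z"
| "prog_tm (Proj i) = proj (num i)"
| "prog_tm (Comp f gs) = comp (prog_tm f) (list_tm (map prog_tm gs))"
| "prog_tm (Prec f g) = prec (prog_tm f) (prog_tm g)"
| "prog_tm (Mu f) = mu (prog_tm f)"

lemma ground_list_tm [simp]: "ground (list_tm ts) \<longleftrightarrow> (\<forall>t\<in>set ts. ground t)"
  by (induction ts) auto

lemma ground_prog_tm [simp]: "ground (prog_tm r)"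
  by (induction r rule: prog_tm.induct) auto

lemma evals_imp_evt: "evals r xs y \<Longrightarrow> evt (prog_tm r) (list_tm (map num xs)) (num y)"
proof (induction rule: evals.induct)
  case (Zero xs)
  then show ?case by (simp add: evt.zero)
next
  case (Succ x)
  then show ?case using evt.succ by simp
next
  case (Proj i xs)
  then show ?case
  proof (induction i arbitrary: xs)
    case 0
    then show ?case by (cases xs) (auto intro: evt.proj_0)
  next
    case (Suc i)
    then show ?case by (cases xs) (auto intro: evt.proj_S)
  qed
next
  case (Comp xs gs ys f z)
  \<comment> \<open>The list of inner programs is itself a program, evaluated entry by entry and
    ending with \<open>Z\<close> as the empty list.\<close>
  from Comp(1) have "evt (list_tm (map prog_tm gs)) (list_tm (map num xs)) (list_tm (map num ys))"
    by (induction rule: list_all2_induct) (auto intro: evt.zero evt.cons)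
  with Comp.IH(2) show ?case by (auto intro: evt.comp)
next
  case (Prec_0 f xs y g)
  then show ?case by (auto intro: evt.prec_0)
next
  case (Prec_Suc f g n xs y z)
  then show ?case by (auto intro: evt.prec_S)
next
  case (Mu f n xs)
  \<comment> \<open>At \<open>k = n\<close> this is the \<open>nonzero\<close> premise of the rule
    \<open>mu\<close>; the positive values below \<open>n\<close> drive the induction.\<close>
  have "evt (nonzero (prog_tm f)) (cons (num k) (list_tm (map num xs))) Z" if "k \<le> n" for k
    using that
  proof (induction k)
    case 0
    then show ?case by (auto intro: evt.nonzero_0)
  next
    case (Suc k)
    then have "\<exists>y. evt (prog_tm f) (list_tm (map num (k # xs))) (num (Suc y))"
      using Mu.IH(2) by (metis Suc_le_eq)
    with Suc show ?case by (auto intro: evt.nonzero_S)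
  qed
  from this[of n] Mu.IH(1) show ?case by (auto intro: evt.mu)
qed

section \<open>Determinism of \<open>evt\<close>\<close>

inductive_cases evt_elims:
  "evt Z xs z" "evt (S Z) xs z" "evt (proj Z) xs z" "evt (proj (S i)) xs z"
  "evt (cons g gs) xs z" "evt (comp f gs) xs z" "evt (prec f g) (cons Z xs) z"
  "evt (prec f g) (cons (S n) xs) z" "evt (nonzero f) xs z" "evt (mu f) xs z"

lemma num_inject [simp]: "num m = num n \<longleftrightarrow> m = n"
proof (induction m arbitrary: n)
  case 0
  then show ?case by (cases n) auto
next
  case (Suc m)
  then show ?case by (cases n) auto
qed

text \<open>Determinism alone is too weak for \<open>mu\<close>: uniqueness of the value
  \<open>Z\<close> of \<open>nonzero f\<close> says nothing about \<open>f\<close> at smaller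
  arguments. The second conjunct therefore records that all values of \<open>f\<close> there are one
  fixed successor.\<close>

lemma evt_deterministic_aux:
  "evt e xs y \<Longrightarrow> (\<forall>z. evt e xs z \<longrightarrow> z = y) \<and>
    (\<forall>f ys k. e = nonzero f \<longrightarrow> xs = cons (num k) ys \<longrightarrow>
      (\<forall>j<k. \<exists>w. \<forall>z. evt f (cons (num j) ys) z \<longrightarrow> z = S w))"
proof (induction rule: evt.induct)
  case (zero xs)
  show ?case by (simp, blast elim: evt_elims(1))
next
  case (succ x)
  have "w = S x" if "evt (S Z) (cons x Z) w" for w
    using that by (rule evt_elims(2)) simp
  then show ?case by simp
next
  case (proj_0 x xs)
  have "w = x" if "evt (proj Z) (cons x xs) w" for w
    using that by (rule evt_elims(3)) simp
  then show ?case by simp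
next
  case (proj_S i xs y x)
  have "w = y" if "evt (proj (S i)) (cons x xs) w" for w
    using that by (rule evt_elims(4)) (use proj_S.IH in simp)
  then show ?case by simp
next
  case (cons g xs y gs ys)
  have "w = cons y ys" if "evt (cons g gs) xs w" for w
    using that by (rule evt_elims(5)) (use cons.IH in blast)
  then show ?case by simp
next
  case (comp gs xs ys f z)
  have "w = z" if "evt (comp f gs) xs w" for w
    using that by (rule evt_elims(6)) (use comp.IH in blast)
  then show ?case by simp
next
  case (prec_0 f xs y g)
  have "w = y" if "evt (prec f g) (cons Z xs) w" for w
    using that by (rule evt_elims(7)) (use prec_0.IH in blast)
  then show ?case by simp
next
  case (prec_S f g n xs y z)
  have "w = z" if "evt (prec f g) (cons (S n) xs) w" for w
    using that by (rule evt_elims(8)) (use prec_S.IH in blast)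
  then show ?case by simp
next
  case (nonzero_0 f xs)
  have "w = Z" if "evt (nonzero f) (cons Z xs) w" for w
    using that by (rule evt_elims(9))
  moreover have "k = 0" if "num k = Z" for k
    using that by (cases k) auto
  ultimately show ?case by auto
next
  case (nonzero_S f n xs y)
  have "w = Z" if "evt (nonzero f) (cons (S n) xs) w" for w
    using that by (rule evt_elims(9))
  moreover have "\<exists>w. \<forall>z. evt f (cons (num j) xs) z \<longrightarrow> z = S w" if k: "S n = num k" and j: "j < k" for j k
  proof -
    from k j obtain l where l: "k = Suc l" "n = num l" by (cases k) auto
    show ?thesis
    proof (cases "j = l")
      case True
      with nonzero_S.IH(2) l show ?thesis by blast
    next
      case False
      with j l have "j < l" by simp
      with nonzero_S.IH(1) l show ?thesis by blast
    qed
  qed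
  ultimately show ?case by auto
next
  case (mu f n xs)
  have "z = n" if "evt (mu f) xs z" for z
  proof -
    obtain k where k: "n = num k" using evt_nonzero[OF mu.hyps(1)] by auto
    from that have z: "evt (nonzero f) (cons z xs) Z" "evt f (cons z xs) Z"
      by (auto elim: evt_elims(10))
    from evt_nonzero[OF z(1)] obtain l
      where l: "z = num l" "\<And>j. j < l \<Longrightarrow> \<exists>w. evt f (cons (num j) xs) (S w)" by auto
    \<comment> \<open>If \<open>k < l\<close>, the second search finds a successor at
      \<open>n\<close>, where the induction hypothesis allows only \<open>Z\<close>. If
      \<open>l < k\<close>, the second conjunct makes every value at \<open>l\<close> a successor,
      although the second search ends there with \<open>Z\<close>.\<close>
    have "\<not> k < l"
    proof
      assume "k < l"
      then obtain w where "evt f (cons n xs) (S w)" using l(2) k by blast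
      with mu.IH(2) have "S w = Z" by blast
      then show False by simp
    qed
    moreover have "\<not> l < k"
    proof
      assume "l < k"
      with mu.IH(1) k obtain w where "\<And>y. evt f (cons (num l) xs) y \<Longrightarrow> y = S w" by blast
      with z(2) l(1) have "Z = S w" by blast
      then show False by simp
    qed
    ultimately show ?thesis using k l(1) by simp
  qed
  then show ?case by simp
qed

lemma evt_deterministic: "evt e xs y \<Longrightarrow> evt e xs z \<Longrightarrow> z = y"
  using evt_deterministic_aux by blast


section \<open>Two copies of the Herbrand model\<close>

text \<open>Only \<open>S\<close> remembers in which copy its argument lies, and the relation \<open>evt\<close> ignores the
  copies.\<close>

definition copies_fun :: "nat \<Rightarrow> (bool \<times> tm) list \<Rightarrow> bool \<times> tm" where
  "copies_fun f ds = (f = Suc 0 \<and> length ds = Suc 0 \<and> fst (hd ds), Fn f (map snd ds))"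

fun copies_rel :: "nat \<Rightarrow> (bool \<times> tm) list \<Rightarrow> bool" where
  "copies_rel r [a, b, c] = evt (snd a) (snd b) (snd c)"
| "copies_rel r ds = False"

abbreviation "cval \<equiv> val copies_fun"
abbreviation "csat \<equiv> sat copies_fun copies_rel"

lemma cval_Fn:
  "cval e (Fn f ts) =
    (f = Suc 0 \<and> length ts = Suc 0 \<and> fst (cval e (hd ts)), Fn f (map (\<lambda>t. snd (cval e t)) ts))"
  by (cases ts) (auto simp: copies_fun_def)

lemma sat_closure: "(\<And>e. sat F R e p) \<Longrightarrow> sat F R e (closure p)"
proof -
  have "(\<And>e. sat F R e p) \<Longrightarrow> sat F R e (foldr All vs p)" for vs
    by (induction vs arbitrary: e) auto
  then show "(\<And>e. sat F R e p) \<Longrightarrow> sat F R e (closure p)"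
    unfolding closure_def .
qed

text \<open>Neither the relation nor the equality-free clauses see the copies, so each clause
  reduces to a rule of \<open>evt\<close>, and \<open>conflict\<close> to its determinism.\<close>

lemma csat_horn_theory': "p \<in> horn_theory' \<Longrightarrow> csat e p"
  unfolding horn_theory'_def horn_theory_def
  by (auto intro!: sat_closure simp: horn_clauses_def conflict_def Let_def copies_fun_def
      intro: evt.intros dest: evt_deterministic)

section \<open>Consistency of the two Horn theories\<close>

lemma consistentI: "(\<And>p e. p \<in> T \<Longrightarrow> sat F R e p) \<Longrightarrow> consistent L T"
  unfolding consistent_def by (metis soundness sat.simps(3))

lemma consistent_RE_finite_theory:
  assumes "finite T" "consistent comp_lang T" "\<And>p. p \<in> T \<Longrightarrow> fm_in comp_lang p \<and> fv p = {}"
  shows "consistent_RE_theory comp_lang T"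
  using assms unfolding consistent_RE_theory_def
  by (auto intro!: finite_imp_recursive_set recursive_imp_re_set) (auto simp: comp_lang_def)

lemma closure_sentence:
  "fm_in L p \<Longrightarrow> fv p \<subseteq> {..<6} \<Longrightarrow> fm_in L (closure p) \<and> fv (closure p) = {}"
proof -
  have "fm_in L p \<Longrightarrow> fm_in L (foldr All vs p) \<and> fv (foldr All vs p) = fv p - set vs" for vs
    by (induction vs) auto
  then show "fm_in L p \<Longrightarrow> fv p \<subseteq> {..<6} \<Longrightarrow> fm_in L (closure p) \<and> fv (closure p) = {}"
    unfolding closure_def by auto
qed

lemma consistent_RE_horn_theory': "consistent_RE_theory comp_lang horn_theory'"
proof (rule consistent_RE_finite_theory)
  show "finite horn_theory'"
    by (simp add: horn_theory'_def horn_theory_def horn_clauses_def Let_def)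
  show "consistent comp_lang horn_theory'"
    using csat_horn_theory' by (rule consistentI)
  have "fm_in comp_lang p \<and> fv p \<subseteq> {..<6}" if "p \<in> insert conflict horn_clauses" for p
    using that by (auto simp: conflict_def horn_clauses_def Let_def comp_lang_def)
  then show "fm_in comp_lang p \<and> fv p = {}" if "p \<in> horn_theory'" for p
    using that closure_sentence unfolding horn_theory'_def horn_theory_def by blast
qed

lemma horn_theory_subset: "horn_theory \<subseteq> horn_theory'"
  by (auto simp: horn_theory'_def)

text \<open>Consistency is inherited from the larger theory, since every proof from
  \<open>horn_theory\<close> is one from \<open>horn_theory'\<close>.\<close>

lemma consistent_RE_horn_theory: "consistent_RE_theory comp_lang horn_theory"
  using consistent_RE_horn_theory' horn_theory_subset
  by (intro consistent_RE_finite_theory)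
    (auto simp: consistent_RE_theory_def consistent_def horn_theory_def horn_clauses_def Let_def
      dest: proves_mono)

lemma horn_theory_computes:
  assumes "horn_theory \<subseteq> T" "evals r xs y"
  shows "proves comp_lang T (Ev (prog_tm r) (list_tm (map num xs)) (num y))"
  using evt_imp_proves[OF assms(1) evals_imp_evt[OF assms(2)]] by simp

section \<open>Representability in the Horn theories\<close>

definition computes_fm :: "recf \<Rightarrow> fm" where
  "computes_fm r = Ev (prog_tm r) (cons (Var 0) Z) (num 1)"

lemma computes_fm_props:
  "fm_in comp_lang (computes_fm r)" "fv (computes_fm r) \<subseteq> {0}"
  "inst (computes_fm r) [n] = Ev (prog_tm r) (list_tm (map num [n])) (num 1)"
proof -
  have r: "tm_in comp_lang (prog_tm r)" "fv_tm (prog_tm r) = {}"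
    using ground_prog_tm[of r] by (auto simp: ground_def)
  then show "fm_in comp_lang (computes_fm r)" "fv (computes_fm r) \<subseteq> {0}"
    by (auto simp: computes_fm_def comp_lang_def)
  show "inst (computes_fm r) [n] = Ev (prog_tm r) (list_tm (map num [n])) (num 1)"
    using r(2) by (simp add: computes_fm_def inst_def subst_tm_closed)
qed

lemma horn_theory'_conflict:
  assumes "ground e" "ground xs" "proves comp_lang horn_theory' (Ev e xs (num 0))"
  shows "proves comp_lang horn_theory' (Neg (Ev e xs (num 1)))"
proof -
  have "proves comp_lang horn_theory'
      (subst (\<lambda>i. if i < 6 then [e, e, e, xs, e, e] ! i else Var i) conflict)"
    using assms(1,2)
    by (intro proves_closure) (auto simp: horn_theory'_def conflict_def comp_lang_def)
  then show ?thesis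
    using assms(3) by (auto simp: conflict_def intro: proves.MP)
qed

lemma RSS_horn_theory': "RSS comp_lang horn_theory'"
  unfolding RSS_def
proof (intro allI impI)
  fix A assume "recursive_set A"
  then obtain r where r: "\<And>n. evals r [n] (if n \<in> A then 1 else 0)"
    using recursive_set_iff by auto
  have c: "proves comp_lang horn_theory'
      (Ev (prog_tm r) (list_tm (map num [n])) (num (if n \<in> A then 1 else 0)))" for n
    using horn_theory_computes[OF horn_theory_subset r] .
  have "proves comp_lang horn_theory' (inst (computes_fm r) [n])" if "n \<in> A" for n
    using c[of n] that by (simp only: computes_fm_props if_True)
  moreover have "proves comp_lang horn_theory' (Neg (inst (computes_fm r) [n]))" if "n \<notin> A" for n
    unfolding computes_fm_props
    using c[of n] that by (intro horn_theory'_conflict) auto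
  ultimately show "strongly_representable comp_lang horn_theory' A"
    unfolding strongly_representable_def using computes_fm_props(1,2) by blast
qed

lemma RSW_horn_theory: "RSW comp_lang horn_theory"
  unfolding RSW_def
proof (intro allI impI)
  fix A assume "recursive_set A"
  then obtain r where r: "\<And>n. evals r [n] (if n \<in> A then 1 else 0)"
    using recursive_set_iff by auto
  have c: "proves comp_lang T
      (Ev (prog_tm r) (list_tm (map num [n])) (num (if n \<in> A then 1 else 0)))"
    if "horn_theory \<subseteq> T" for n T
    using horn_theory_computes[OF that r] .
  \<comment> \<open>A proof of a wrong instance would also be one in \<open>horn_theory'\<close>,
    which refutes that instance and is consistent.\<close>
  have "n \<in> A" if "proves comp_lang horn_theory (inst (computes_fm r) [n])" for n
  proof (rule ccontr)
    assume "n \<notin> A"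
    then have "proves comp_lang horn_theory' (Neg (inst (computes_fm r) [n]))"
      unfolding computes_fm_props
      using c[OF horn_theory_subset, of n] by (intro horn_theory'_conflict) auto
    with proves_mono[OF that horn_theory_subset] consistent_RE_horn_theory' show False
      unfolding consistent_RE_theory_def consistent_def by blast
  qed
  moreover have "proves comp_lang horn_theory (inst (computes_fm r) [n])" if "n \<in> A" for n
    using c[OF order_refl, of n] that by (simp only: computes_fm_props if_True)
  ultimately show "weakly_representable comp_lang horn_theory A"
    unfolding weakly_representable_def using computes_fm_props(1,2) by blast
qed

text \<open>Without \<open>conflict\<close> the theory is satisfied by a one-point structure, in which
  no formula separates two numerals.\<close>

lemma not_RSS_horn_theory: "\<not> RSS comp_lang horn_theory"
proof
  assume "RSS comp_lang horn_theory"
  moreover have "recursive_set {0}" by (rule finite_imp_recursive_set) simp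
  ultimately have "strongly_representable comp_lang horn_theory {0}"
    unfolding RSS_def by blast
  then obtain p where *: "\<And>n. n \<in> {0} \<Longrightarrow> proves comp_lang horn_theory (inst p [n])"
    "\<And>n. n \<notin> {0} \<Longrightarrow> proves comp_lang horn_theory (Neg (inst p [n]))"
    unfolding strongly_representable_def by blast
  then have p: "proves comp_lang horn_theory (inst p [0])"
    "proves comp_lang horn_theory (Neg (inst p [1]))"
    by simp_all
  let ?sat = "sat (\<lambda>_ _. ()) (\<lambda>_ _. True)"
  have T: "?sat e q" if "q \<in> horn_theory" for e q
    using that unfolding horn_theory_def
    by (auto intro!: sat_closure simp: horn_clauses_def Let_def)
  have "?sat e (inst p [0]) = ?sat e (inst p [1])" for e
    unfolding inst_def sat_closed_subst[OF closed_subst_inst] by simp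
  then show False
    using soundness[OF p(1), of "\<lambda>_ _. ()" "\<lambda>_ _. True"]
      soundness[OF p(2), of "\<lambda>_ _. ()" "\<lambda>_ _. True"] T by auto
qed


section \<open>Doubling is not definable\<close>

text \<open>In the two-copy model only \<open>S\<close> passes on the copy of its argument, so
  distances are measured in leading successors.\<close>

fun depth :: "tm \<Rightarrow> nat" where
  "depth (Fn f [t]) = (if f = Suc 0 then Suc (depth t) else 0)"
| "depth _ = 0"

lemma depth_num [simp]: "depth (num n) = n"
  by (induction n) auto

text \<open>The invariant of an Ehrenfeucht--Fraisse game: one assignment arises from the other by
  exchanging the two copies on whole blocks of depths, where \<open>r\<close> bounds from below the size of the
  gaps between blocks and the depth at which the first one may start.  A quantifier halves \<open>r\<close>.\<close>

definition similar :: "nat \<Rightarrow> (nat \<Rightarrow> bool \<times> tm) \<Rightarrow> (nat \<Rightarrow> bool \<times> tm) \<Rightarrow> bool" where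
  "similar r \<sigma> \<tau> \<longleftrightarrow>
     (\<forall>x. snd (\<sigma> x) = snd (\<tau> x)) \<and>
     (\<forall>x. depth (snd (\<sigma> x)) \<le> r \<longrightarrow> \<sigma> x = \<tau> x) \<and>
     (\<forall>x y. depth (snd (\<sigma> x)) \<le> depth (snd (\<sigma> y)) + r \<longrightarrow>
       depth (snd (\<sigma> y)) \<le> depth (snd (\<sigma> x)) + r \<longrightarrow>
       (fst (\<sigma> x) = fst (\<tau> x)) = (fst (\<sigma> y) = fst (\<tau> y)))"

lemma similar_imp_snd_eq: "similar r \<sigma> \<tau> \<Longrightarrow> snd \<circ> \<sigma> = snd \<circ> \<tau>"
  by (rule ext) (simp add: similar_def)

lemma similar_sym: "similar r \<sigma> \<tau> \<Longrightarrow> similar r \<tau> \<sigma>"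
  unfolding similar_def by metis

lemma similar_mono: "similar r \<sigma> \<tau> \<Longrightarrow> q \<le> r \<Longrightarrow> similar q \<sigma> \<tau>"
  unfolding similar_def by (meson add_left_mono le_trans)

text \<open>The answer to \<open>d\<close> keeps its term and changes its copy exactly if
  \<open>d\<close> is deeper than \<open>r\<close> and lies within \<open>r\<close> of a flipped
  element. Two elements within \<open>r\<close> of \<open>d\<close> are within \<open>2 * r\<close>
  of each other, so they agree on being flipped.\<close>

lemma similar_extend:
  assumes "similar (2 * r) \<sigma> \<tau>"
  shows "\<exists>d'. similar r (\<sigma>(x := d)) (\<tau>(x := d'))"
proof -
  let ?near = "\<lambda>y. depth (snd d) \<le> depth (snd (\<sigma> y)) + r \<and> depth (snd (\<sigma> y)) \<le> depth (snd d) + r"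
  let ?flip = "\<lambda>y. fst (\<sigma> y) \<noteq> fst (\<tau> y)"
  define b where "b \<longleftrightarrow> r < depth (snd d) \<and> (\<exists>y. ?near y \<and> ?flip y)"
  have s: "\<And>y. snd (\<sigma> y) = snd (\<tau> y)" "\<And>y. depth (snd (\<sigma> y)) \<le> 2 * r \<Longrightarrow> \<sigma> y = \<tau> y"
    and flip: "\<And>y z. depth (snd (\<sigma> y)) \<le> depth (snd (\<sigma> z)) + 2 * r \<Longrightarrow>
       depth (snd (\<sigma> z)) \<le> depth (snd (\<sigma> y)) + 2 * r \<Longrightarrow> ?flip y = ?flip z"
    using assms unfolding similar_def by blast+
  have b: "b = ?flip y" if y: "?near y" for y
  proof (cases "depth (snd d) \<le> r")
    case True
    \<comment> \<open>A neighbour of an element of depth at most \<open>r\<close> has depth at most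
      \<open>2 * r\<close> and is therefore fixed.\<close>
    with y have "\<sigma> y = \<tau> y" by (intro s(2)) linarith
    with True show ?thesis by (simp add: b_def)
  next
    case False
    have "?flip z = ?flip y" if "?near z" for z
      using y that by (intro flip) linarith+
    with y have "(\<exists>z. ?near z \<and> ?flip z) \<longleftrightarrow> ?flip y" by blast
    with False show ?thesis by (simp only: b_def not_le simp_thms)
  qed
  have "similar r (\<sigma>(x := d)) (\<tau>(x := (fst d \<noteq> b, snd d)))"
    unfolding similar_def
  proof (intro conjI allI impI)
    fix y z
    let ?s = "\<sigma>(x := d)" and ?t = "\<tau>(x := (fst d \<noteq> b, snd d))"
    show "snd (?s y) = snd (?t y)" using s(1) by simp
    show "?s y = ?t y" if "depth (snd (?s y)) \<le> r"
      using that s(2)[of y] by (cases "y = x") (auto simp: b_def prod_eq_iff)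
    assume near: "depth (snd (?s y)) \<le> depth (snd (?s z)) + r"
      "depth (snd (?s z)) \<le> depth (snd (?s y)) + r"
    have x: "(fst (?s x) = fst (?t x)) = (\<not> b)" by auto
    consider "y = x" "z = x" | "y = x" "z \<noteq> x" | "y \<noteq> x" "z = x" | "y \<noteq> x" "z \<noteq> x" by blast
    then show "(fst (?s y) = fst (?t y)) = (fst (?s z) = fst (?t z))"
    proof cases
      case 2
      then have "b = ?flip z" using near by (intro b) simp
      with 2 x show ?thesis by simp
    next
      case 3
      then have "b = ?flip y" using near by (intro b) simp
      with 3 x show ?thesis by simp
    next
      case 4
      then have "?flip y = ?flip z" using near by (intro flip) simp_all
      with 4 show ?thesis by auto
    qed simp
  qed
  then show ?thesis by blast
qed

text \<open>Stripping the leading \<open>S\<close> of a term ends at a variable, whose copy is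
  inherited, or at another symbol, whose value lies in the first copy at depth 0.\<close>

lemma cval_cases:
  obtains x j where "j \<le> size t" "\<And>e. fst (cval e t) = fst (e x)"
      "\<And>e. depth (snd (cval e t)) = depth (snd (e x)) + j"
  | "\<And>e. \<not> fst (cval e t)" "\<And>e. depth (snd (cval e t)) \<le> size t"
proof -
  have "(\<exists>x j. j \<le> size t \<and> (\<forall>e. fst (cval e t) = fst (e x) \<and>
      depth (snd (cval e t)) = depth (snd (e x)) + j)) \<or>
    (\<forall>e. \<not> fst (cval e t) \<and> depth (snd (cval e t)) \<le> size t)"
  proof (induction t)
    case (Var x)
    show ?case by (intro disjI1 exI[of _ x] exI[of _ 0]) auto
  next
    case (Fn f ts)
    show ?case
    proof (cases "f = Suc 0 \<and> length ts = Suc 0")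
      case True
      then obtain t where t: "f = Suc 0" "ts = [t]" by (cases ts) auto
      have "t \<in> set ts" by (simp add: t)
      from Fn.IH[OF this] show ?thesis
      proof
        assume "\<exists>x j. j \<le> size t \<and> (\<forall>e. fst (cval e t) = fst (e x) \<and>
          depth (snd (cval e t)) = depth (snd (e x)) + j)"
        then obtain x j where "j \<le> size t" "\<And>e. fst (cval e t) = fst (e x) \<and>
          depth (snd (cval e t)) = depth (snd (e x)) + j"
          by blast
        then show ?thesis
          unfolding t cval_Fn by (intro disjI1 exI[of _ x] exI[of _ "Suc j"]) simp
      next
        assume "\<forall>e. \<not> fst (cval e t) \<and> depth (snd (cval e t)) \<le> size t"
        then show ?thesis
          unfolding t cval_Fn by (intro disjI2) (simp add: le_SucI)
      qed
    next
      case False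
      have "depth (Fn f us) = 0" if "length us = length ts" for us
        using False that by (cases "Fn f us" rule: depth.cases) auto
      with False show ?thesis unfolding cval_Fn by (intro disjI2) auto
    qed
  qed
  then show thesis using that by blast
qed

lemma snd_cval: "snd (cval e t) = subst_tm (snd \<circ> e) t"
  by (induction t) (auto simp: copies_fun_def)

lemma copies_rel_cong: "map snd ds = map snd es \<Longrightarrow> copies_rel r ds = copies_rel r es"
  by (cases "(r, ds)" rule: copies_rel.cases; cases "(r, es)" rule: copies_rel.cases) auto

text \<open>An equation compares variables only up to offsets bounded by its term sizes,
  \<open>Rel\<close> does not see the copies, and a quantifier doubles the rank as
  \<open>similar_extend\<close> requires.\<close>

primrec rank :: "fm \<Rightarrow> nat" where
  "rank (Eq s t) = size s + size t"
| "rank (Rel r ts) = 0"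
| "rank (Neg p) = rank p"
| "rank (Imp p q) = rank p + rank q"
| "rank (All x p) = 2 * rank p"

lemma similar_imp_csat_iff: "similar (rank p) \<sigma> \<tau> \<Longrightarrow> csat \<sigma> p = csat \<tau> p"
proof (induction p arbitrary: \<sigma> \<tau>)
  case (Eq s t)
  let ?r = "rank (Eq s t)"
  have eq: "snd (cval \<sigma> u) = snd (cval \<tau> u)" for u
    unfolding snd_cval similar_imp_snd_eq[OF Eq] ..
  have low: "\<sigma> x = \<tau> x" if "depth (snd (\<sigma> x)) \<le> ?r" for x
    using Eq that unfolding similar_def by blast
  have flip: "(fst (\<sigma> x) = fst (\<tau> x)) = (fst (\<sigma> y) = fst (\<tau> y))"
    if "depth (snd (\<sigma> x)) \<le> depth (snd (\<sigma> y)) + ?r" "depth (snd (\<sigma> y)) \<le> depth (snd (\<sigma> x)) + ?r"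
    for x y
    using Eq that unfolding similar_def by blast
  \<comment> \<open>When both sides have the same underlying term, their variables have nearly equal
    depths and are flipped together, or a lone variable is shallow and hence fixed.\<close>
  have "(fst (cval \<sigma> s) = fst (cval \<sigma> t)) = (fst (cval \<tau> s) = fst (cval \<tau> t))"
    if "snd (cval \<sigma> s) = snd (cval \<sigma> t)"
  proof -
    from that have d: "depth (snd (cval \<sigma> s)) = depth (snd (cval \<sigma> t))" by simp
    show ?thesis
    proof (cases s rule: cval_cases)
      case s: (1 x i)
      show ?thesis
      proof (cases t rule: cval_cases)
        case t: (1 y j)
        have "(fst (\<sigma> x) = fst (\<tau> x)) = (fst (\<sigma> y) = fst (\<tau> y))"
          using s(1,3) t(1,3) d by (intro flip) simp_all
        then show ?thesis unfolding s(2) t(2) by auto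
      next
        case t: 2
        have "depth (snd (\<sigma> x)) \<le> ?r" using d s(3)[of \<sigma>] t(2)[of \<sigma>] by simp
        from low[OF this] t(1) show ?thesis unfolding s(2) by auto
      qed
    next
      case s: 2
      show ?thesis
      proof (cases t rule: cval_cases)
        case t: (1 y j)
        have "depth (snd (\<sigma> y)) \<le> ?r" using d t(3)[of \<sigma>] s(2)[of \<sigma>] by simp
        from low[OF this] s(1) show ?thesis unfolding t(2) by auto
      next
        case t: 2
        then show ?thesis using s(1) by auto
      qed
    qed
  qed
  then show ?case by (auto simp: prod_eq_iff eq)
next
  case (Rel r ts)
  have "map snd (map (cval \<sigma>) ts) = map snd (map (cval \<tau>) ts)"
    by (simp add: snd_cval similar_imp_snd_eq[OF Rel])
  from copies_rel_cong[OF this] show ?case by (simp only: sat.simps)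
next
  case (Neg p)
  from Neg.IH[of \<sigma> \<tau>] Neg.prems show ?case by simp
next
  case (Imp p q)
  have "similar (rank p) \<sigma> \<tau>" "similar (rank q) \<sigma> \<tau>"
    by (rule similar_mono[OF Imp.prems], simp)+
  from Imp.IH(1)[OF this(1)] Imp.IH(2)[OF this(2)] show ?case by simp
next
  case (All x p)
  \<comment> \<open>One direction suffices, because \<open>similar\<close> is symmetric.\<close>
  have imp: "csat \<sigma>' (All x p)" if "similar (rank (All x p)) \<sigma>' \<tau>'" "csat \<tau>' (All x p)" for \<sigma>' \<tau>'
    unfolding sat.simps
  proof
    fix d
    from that(1) obtain d' where "similar (rank p) (\<sigma>'(x := d)) (\<tau>'(x := d'))"
      using similar_extend[of "rank p" \<sigma>' \<tau>' x d] unfolding rank.simps by blast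
    from All.IH[OF this] that(2) show "csat (\<sigma>'(x := d)) p"
      unfolding sat.simps by blast
  qed
  show ?case
    using imp[OF All.prems] imp[OF similar_sym[OF All.prems]] by (rule iffI[rotated])
qed

lemma cval_num: "cval e (num n) = (False, num n)"
  by (induction n) (auto simp: copies_fun_def)

lemma recursive_double: "recursive_fun 1 (\<lambda>xs. 2 * hd xs)"
proof -
  let ?g = "Comp Succ [Comp Succ [Proj 1]]"
  have "evals (Prec Zero ?g) [n] (2 * n)" for n
  proof (induction n)
    case 0
    show ?case by (auto intro: evals.Prec_0 evals.Zero)
  next
    case (Suc n)
    have "evals (Proj 1) [n, 2 * n] (2 * n)"
      using evals.Proj[of 1 "[n, 2 * n]"] by simp
    then have "evals ?g [n, 2 * n] (2 * Suc n)"
      using evals_Comp1[OF evals_Comp1[OF _ evals.Succ] evals.Succ] by simp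
    with Suc show ?case by (rule evals.Prec_Suc)
  qed
  then have "evals (Prec Zero ?g) xs (2 * hd xs)" if "length xs = 1" for xs
    using that by (cases xs) auto
  then show ?thesis unfolding recursive_fun_def by blast
qed

text \<open>For \<open>a\<close> above the rank of \<open>p\<close>, the formula cannot distinguish the numeral \<open>2a\<close>
  from its twin in the other copy.\<close>

lemma not_definable_double:
  assumes "T \<subseteq> horn_theory'"
  shows "\<not> definable comp_lang T 1 (\<lambda>xs. 2 * hd xs)"
proof
  assume "definable comp_lang T 1 (\<lambda>xs. 2 * hd xs)"
  then obtain p where p: "fv p \<subseteq> {0..1}"
    "\<And>as. length as = 1 \<Longrightarrow>
      proves comp_lang T (All 1 (Iff (inst p as) (Eq (Var 1) (num (2 * hd as)))))"
    unfolding definable_def by blast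
  define a where "a = Suc (rank p)"
  have "csat e (All 1 (Iff (inst p [a]) (Eq (Var 1) (num (2 * a)))))" for e
  proof (rule soundness)
    show "proves comp_lang T (All 1 (Iff (inst p [a]) (Eq (Var 1) (num (2 * a)))))"
      using p(2)[of "[a]"] by simp
  qed (use csat_horn_theory' assms in blast)
  then have *: "csat (e(1 := d)) (Iff (inst p [a]) (Eq (Var 1) (num (2 * a))))" for e d
    by (simp only: sat.simps)
  \<comment> \<open>In the model, \<open>p\<close> with the first-copy numeral \<open>a\<close> as
    input must hold of the first-copy numeral \<open>2 * a\<close> alone, for an arbitrary element
    \<open>e 1\<close>.\<close>
  have iff: "csat (\<lambda>x. if x = 0 then (False, num a) else e x) p \<longleftrightarrow> e 1 = (False, num (2 * a))"
    for e
  proof -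
    have "csat e (inst p [a]) \<longleftrightarrow> e 1 = (False, num (2 * a))"
      using *[of e "e 1"] unfolding fun_upd_triv
      by (simp only: Iff_def Conj_def sat.simps val.simps(1) cval_num) blast
    moreover have "(\<lambda>x. cval e (if x < length [a] then num ([a] ! x) else Var x)) =
        (\<lambda>x. if x = 0 then (False, num a) else e x)"
      by (auto simp: cval_num)
    ultimately show ?thesis
      unfolding inst_def sat_closed_subst[OF closed_subst_inst] by (simp only:)
  qed
  define e where "e b x = (if x = 1 then (b, num (2 * a)) else (False, Z))" for b and x :: nat
  let ?e = "\<lambda>b x. if x = 0 then (False, num a) else e b x"
  \<comment> \<open>Only variable 1 is flipped. Its depth \<open>2 * a\<close> exceeds the depths
    \<open>a\<close> and 0 of the others by at least \<open>a\<close>, which is more than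
    \<open>rank p\<close>.\<close>
  have "similar (rank p) (?e False) (?e True)"
    unfolding similar_def by (auto simp: e_def a_def simp del: num_simps num.simps)
  then have indist: "csat (?e False) p \<longleftrightarrow> csat (?e True) p"
    by (rule similar_imp_csat_iff)
  have e: "e b 1 = (b, num (2 * a))" for b
    by (simp add: e_def)
  from e have "csat (?e False) p"
    by (rule iff[THEN iffD2])
  then have "csat (?e True) p"
    by (rule indist[THEN iffD1])
  then have "e True 1 = (False, num (2 * a))"
    by (rule iff[THEN iffD1])
  with e[of True] show False
    by simp
qed

lemma not_RFD: "T \<subseteq> horn_theory' \<Longrightarrow> \<not> RFD comp_lang T"
  using not_definable_double recursive_double unfolding RFD_def by blast


section \<open>The implications between the three properties\<close>

theorem theorem7p9:
  shows
    "(\<forall>L T. consistent_RE_theory L T \<and> (\<exists>m n. proves L T (Neg (Eq (num m) (num n)))) \<and> RFD L T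
        \<longrightarrow> RSS L T \<and> RSW L T)
     \<and> (\<exists>L T. consistent_RE_theory L T \<and> RSS L T \<and> \<not> RFD L T)
     \<and> (\<forall>L T. consistent_RE_theory L T \<and> RSS L T \<longrightarrow> RSW L T)
     \<and> (\<exists>L T. consistent_RE_theory L T \<and> RSW L T \<and> \<not> RSS L T)
     \<and> (\<exists>L T. consistent_RE_theory L T \<and> RSW L T \<and> \<not> RFD L T)"
proof (intro conjI allI impI; (elim conjE exE)?)
  fix L T m n
  assume "consistent_RE_theory L T" "proves L T (Neg (Eq (num m) (num n)))" "RFD L T"
  then show "RSS L T" by (rule RFD_imp_RSS)
  with \<open>consistent_RE_theory L T\<close> show "RSW L T" by (rule RSS_imp_RSW)
next
  \<comment> \<open>\<open>horn_theory'\<close> witnesses this separation;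
    \<open>horn_theory\<close> witnesses both separations from \<open>RSW\<close>.\<close>
  show "\<exists>L T. consistent_RE_theory L T \<and> RSS L T \<and> \<not> RFD L T"
    using consistent_RE_horn_theory' RSS_horn_theory' not_RFD[OF order_refl] by blast
next
  fix L T
  assume "consistent_RE_theory L T" "RSS L T"
  then show "RSW L T" by (rule RSS_imp_RSW)
next
  show "\<exists>L T. consistent_RE_theory L T \<and> RSW L T \<and> \<not> RSS L T"
    using consistent_RE_horn_theory RSW_horn_theory not_RSS_horn_theory by blast
  show "\<exists>L T. consistent_RE_theory L T \<and> RSW L T \<and> \<not> RFD L T"
    using consistent_RE_horn_theory RSW_horn_theory not_RFD[OF horn_theory_subset] by blast
qed

end
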